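(* A finite commutative unital ring $K$ is a principal ideal ring if and only if $\varTheta(K)$ is isomorphic to a finite tensor product of staircase graphs.
   Context: A principal ideal ring is a commutative unital ring in which every ideal is principal (the zero ring is allowed). On a finite commutative unital ring $K$, elements $a,b$ are associated, $a\sim b$, if $a=bu$ for some invertible $u\in K$; $[a]$ is the class of $a$. The graph $\varTheta(K)$ has as vertices all associatedness classes of elements of $K$ (including $[0]$ and $[1]$), and vertices $[u]$, $[v]$ (not necessarily distinct) are adjacent if and only if $uv=0$; so loops are allowed. The tensor product $G\times H$ of graphs has vertex set $V(G)\times V(H)$, and $(g,h)$ is adjacent to $(g',h')$ if and only if $g$ is adjacent to $g'$ and $h$ is adjacent to $h'$. For a nonnegative integer $k$, the staircase graph $SG_k$ is the graph (loops allowed, no multiple edges), unique up to isomorphism, with $k+1$ vertices whose degrees are $1,2,\ldots,k+1$, where a loop contributes $1$ to the degree; explicitly it has vertices $v_0,\ldots,v_k$, with $v_i$ and $v_j$ (not necessarily distinct) adjacent if and only if $i+j\geq k$. *)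

theory Defs
  imports
    "HOL-Algebra.Algebra"
    "Graph_Theory.Pair_Digraph"
    "Graph_Theory.Digraph_Isomorphism"
begin

section \<open>Principal ideal rings and associatedness\<close>

text \<open>Unlike \<^locale>\<open>principal_domain\<close>, zero divisors and the zero ring are allowed.\<close>

locale principal_ideal_ring = cring +
  assumes principal: "ideal I R \<Longrightarrow> principalideal I R"

text \<open>The library's \<^const>\<open>associated\<close> means mutual divisibility; here associatedness
  means equality up to a unit factor.\<close>

definition unit_assoc :: "('a, 'b) ring_scheme \<Rightarrow> 'a rel" where
  "unit_assoc R =
    {(a, b). a \<in> carrier R \<and> b \<in> carrier R \<and> (\<exists>u \<in> Units R. a = b \<otimes>\<^bsub>R\<^esub> u)}"

lemma (in cring) unit_assoc_equiv: "equiv (carrier R) (unit_assoc R)"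
proof (rule equivI)
  show "unit_assoc R \<subseteq> carrier R \<times> carrier R"
    by (auto simp: unit_assoc_def)
  show "refl_on (carrier R) (unit_assoc R)"
  proof (rule refl_onI)
    fix x assume "x \<in> carrier R"
    then show "(x, x) \<in> unit_assoc R"
      unfolding unit_assoc_def using Units_one_closed r_one by force
  qed
  show "sym (unit_assoc R)"
  proof (rule symI)
    fix a b assume "(a, b) \<in> unit_assoc R"
    then obtain u where ab: "a \<in> carrier R" "b \<in> carrier R" and u: "u \<in> Units R" "a = b \<otimes> u"
      by (auto simp: unit_assoc_def)
    have "a \<otimes> inv u = b"
      using ab u by (simp add: m_assoc Units_closed)
    then show "(b, a) \<in> unit_assoc R"
      using ab u(1) unfolding unit_assoc_def by (auto intro!: bexI[of _ "inv u"])
  qed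
  show "trans (unit_assoc R)"
  proof (rule transI)
    fix a b c assume "(a, b) \<in> unit_assoc R" "(b, c) \<in> unit_assoc R"
    then obtain u v where abc: "a \<in> carrier R" "b \<in> carrier R" "c \<in> carrier R"
      and uv: "u \<in> Units R" "v \<in> Units R" "a = b \<otimes> u" "b = c \<otimes> v"
      by (auto simp: unit_assoc_def)
    then have "a = c \<otimes> (v \<otimes> u)"
      by (simp add: m_assoc Units_closed)
    then show "(a, c) \<in> unit_assoc R"
      using abc uv unfolding unit_assoc_def by (auto intro!: bexI[of _ "v \<otimes> u"])
  qed
qed

section \<open>Graphs\<close>

text \<open>An undirected graph without multiple edges, loops allowed, is a
  \<^typ>\<open>'a pair_pre_digraph\<close> whose arc relation is symmetric; a loop at \<open>v\<close> is the arc
  \<open>(v, v)\<close>. Graphs are isomorphic if they are related by \<^const>\<open>digraph_iso\<close>, which for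
  such graphs amounts to a bijection of the vertices that preserves and reflects adjacency.\<close>

lemma digraph_iso_with_proj_iff:
  assumes G: "pair_wf_digraph G" and H: "pair_wf_digraph H"
  shows "digraph_iso (with_proj G) (with_proj H) \<longleftrightarrow>
    (\<exists>f. bij_betw f (pverts G) (pverts H) \<and>
      (\<forall>u \<in> pverts G. \<forall>v \<in> pverts G. (u, v) \<in> parcs G \<longleftrightarrow> (f u, f v) \<in> parcs H))"
  (is "?L \<longleftrightarrow> (\<exists>f. ?P f)")
proof
  assume ?L
  then obtain h where h: "pre_digraph.digraph_isomorphism (with_proj G) h"
    and HG: "with_proj H = app_iso h (with_proj G)"
    unfolding digraph_iso_def by blast
  let ?f = "iso_verts h"
  have tl: "iso_tail h = fst" and hd: "iso_head h = snd"
    and vH: "pverts H = ?f ` pverts G" and aH: "parcs H = iso_arcs h ` parcs G"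
    using HG by (auto simp: with_proj_def app_iso_def)
  have inj: "inj_on ?f (pverts G)"
    using h by (simp add: pre_digraph.digraph_isomorphism_def)
  have arc: "iso_arcs h a = (?f (fst a), ?f (snd a))" if "a \<in> parcs G" for a
    using h that by (simp add: pre_digraph.digraph_isomorphism_def tl hd prod_eq_iff)
  have "(u, v) \<in> parcs G \<longleftrightarrow> (?f u, ?f v) \<in> parcs H"
    if uv: "u \<in> pverts G" "v \<in> pverts G" for u v
  proof
    assume "(u, v) \<in> parcs G"
    then show "(?f u, ?f v) \<in> parcs H" using arc[of "(u, v)"] by (force simp: aH)
  next
    assume "(?f u, ?f v) \<in> parcs H"
    then obtain x y where xy: "(x, y) \<in> parcs G" "(?f u, ?f v) = (?f x, ?f y)"
      using arc by (force simp: aH)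
    then have "x \<in> pverts G" "y \<in> pverts G"
      using pair_wf_digraph.in_arcsD1[OF G] pair_wf_digraph.in_arcsD2[OF G] by auto
    then have "x = u" "y = v" using xy(2) uv inj by (auto dest: inj_onD)
    then show "(u, v) \<in> parcs G" using xy by simp
  qed
  then have "?P ?f" using inj vH by (auto simp: bij_betw_def)
  then show "\<exists>f. ?P f" by blast
next
  assume "\<exists>f. ?P f"
  then obtain f where f: "bij_betw f (pverts G) (pverts H)"
    and adj: "\<And>u v. u \<in> pverts G \<Longrightarrow> v \<in> pverts G \<Longrightarrow> (u, v) \<in> parcs G \<longleftrightarrow> (f u, f v) \<in> parcs H"
    by blast
  define h where "h = \<lparr>iso_verts = f, iso_arcs = map_prod f f, iso_head = snd, iso_tail = fst\<rparr>"
  have inj: "inj_on f (pverts G)" and im: "f ` pverts G = pverts H"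
    using f by (auto simp: bij_betw_def)
  have sub: "parcs G \<subseteq> pverts G \<times> pverts G"
    using pair_wf_digraph.in_arcsD1[OF G] pair_wf_digraph.in_arcsD2[OF G] by auto
  have wf: "wf_digraph (with_proj G)"
    using sub by unfold_locales auto
  have "inj_on (map_prod f f) (parcs G)"
    using map_prod_inj_on[OF inj inj] sub by (rule inj_on_subset)
  then have 1: "pre_digraph.digraph_isomorphism (with_proj G) h"
    using wf inj by (auto simp: pre_digraph.digraph_isomorphism_def h_def)
  have "parcs H \<subseteq> map_prod f f ` parcs G"
  proof
    fix e assume e: "e \<in> parcs H"
    then have "fst e \<in> pverts H" "snd e \<in> pverts H"
      using pair_wf_digraph.arc_fst_in_verts[OF H] pair_wf_digraph.arc_snd_in_verts[OF H] by auto
    then obtain x y where xy: "x \<in> pverts G" "y \<in> pverts G" "e = (f x, f y)"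
      using im by (metis imageE prod.collapse)
    then have "(x, y) \<in> parcs G" using adj e by simp
    then show "e \<in> map_prod f f ` parcs G" using xy by force
  qed
  moreover have "map_prod f f ` parcs G \<subseteq> parcs H"
    using adj sub by fastforce
  ultimately have "with_proj H = app_iso h (with_proj G)"
    using im by (auto simp: with_proj_def app_iso_def h_def)
  then show ?L using 1 unfolding digraph_iso_def by blast
qed

text \<open>The adjacency relation consists of all pairs of classes that have representatives with
  product zero; by the lemma below it does not depend on the representatives.\<close>

definition Theta :: "('a, 'b) ring_scheme \<Rightarrow> 'a set pair_pre_digraph" where
  "Theta R = \<lparr>
    pverts = carrier R // unit_assoc R,
    parcs = {(unit_assoc R `` {u}, unit_assoc R `` {v}) | u v.
      u \<in> carrier R \<and> v \<in> carrier R \<and> u \<otimes>\<^bsub>R\<^esub> v = \<zero>\<^bsub>R\<^esub>}\<rparr>"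

lemma (in cring) Theta_adjacent_iff:
  assumes u: "u \<in> carrier R" and v: "v \<in> carrier R"
  shows "(unit_assoc R `` {u}, unit_assoc R `` {v}) \<in> parcs (Theta R) \<longleftrightarrow> u \<otimes> v = \<zero>"
proof
  assume "(unit_assoc R `` {u}, unit_assoc R `` {v}) \<in> parcs (Theta R)"
  then obtain u' v' where c: "u' \<in> carrier R" "v' \<in> carrier R" "u' \<otimes> v' = \<zero>"
    and eq: "unit_assoc R `` {u} = unit_assoc R `` {u'}"
      "unit_assoc R `` {v} = unit_assoc R `` {v'}"
    by (auto simp: Theta_def)
  have "(u, u') \<in> unit_assoc R" "(v, v') \<in> unit_assoc R"
    using eq_equiv_class_iff[OF unit_assoc_equiv] eq u v c by blast+
  then obtain a b where ab: "a \<in> Units R" "b \<in> Units R" "u = u' \<otimes> a" "v = v' \<otimes> b"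
    by (auto simp: unit_assoc_def)
  have "u \<otimes> v = (u' \<otimes> v') \<otimes> (a \<otimes> b)"
    using ab c(1,2) Units_closed by (simp add: m_ac)
  then show "u \<otimes> v = \<zero>" using ab c Units_closed by simp
qed (use u v in \<open>auto simp: Theta_def\<close>)

definition staircase_graph :: "nat \<Rightarrow> nat pair_pre_digraph" where
  "staircase_graph k = \<lparr>
    pverts = {0..k},
    parcs = {(i, j). i \<in> {0..k} \<and> j \<in> {0..k} \<and> i + j \<ge> k}\<rparr>"

lemma staircase_graph_degree:
  assumes "i \<le> k"
  shows "card {j. (i, j) \<in> parcs (staircase_graph k)} = i + 1"
proof -
  have "{j. (i, j) \<in> parcs (staircase_graph k)} = {k - i..k}"
    using assms by (auto simp: staircase_graph_def)
  then show ?thesis using assms by simp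
qed

definition tensor_product ::
    "'a pair_pre_digraph \<Rightarrow> 'b pair_pre_digraph \<Rightarrow> ('a \<times> 'b) pair_pre_digraph" where
  "tensor_product G H = \<lparr>
    pverts = pverts G \<times> pverts H,
    parcs = {((g, h), (g', h')) | g h g' h'. (g, g') \<in> parcs G \<and> (h, h') \<in> parcs H}\<rparr>"

definition rename_verts :: "('a \<Rightarrow> 'b) \<Rightarrow> 'a pair_pre_digraph \<Rightarrow> 'b pair_pre_digraph" where
  "rename_verts f G = \<lparr>pverts = f ` pverts G, parcs = map_prod f f ` parcs G\<rparr>"

text \<open>The iterated tensor product of a list of graphs. A vertex \<open>(g, (g', (g'', \<dots>)))\<close> of the
  iterated product is renamed to the list \<open>[g, g', g'', \<dots>]\<close>, since the type must not depend on
  the number of factors. The empty product is a single vertex with a loop, the neutral element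
  of the tensor product.\<close>

primrec tensor_product_list :: "'a pair_pre_digraph list \<Rightarrow> 'a list pair_pre_digraph" where
  "tensor_product_list [] = \<lparr>pverts = {[]}, parcs = {([], [])}\<rparr>"
| "tensor_product_list (G # Gs) =
    rename_verts (\<lambda>(g, gs). g # gs) (tensor_product G (tensor_product_list Gs))"

lemma pverts_tensor_product_list:
  "gs \<in> pverts (tensor_product_list Gs) \<longleftrightarrow> list_all2 (\<lambda>g G. g \<in> pverts G) gs Gs"
  by (induction Gs arbitrary: gs)
    (auto simp: rename_verts_def tensor_product_def list_all2_Cons2 image_iff)

lemma parcs_tensor_product_list:
  "(gs, hs) \<in> parcs (tensor_product_list Gs) \<longleftrightarrow>
    length gs = length Gs \<and> length hs = length Gs \<and>
    (\<forall>i < length Gs. (gs ! i, hs ! i) \<in> parcs (Gs ! i))"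
proof (induction Gs arbitrary: gs hs)
  case (Cons G Gs)
  have "(gs, hs) \<in> parcs (tensor_product_list (G # Gs)) \<longleftrightarrow>
    (\<exists>g gs' h hs'. gs = g # gs' \<and> hs = h # hs' \<and> (g, h) \<in> parcs G \<and>
      (gs', hs') \<in> parcs (tensor_product_list Gs))"
    by (force simp: rename_verts_def tensor_product_def)
  then show ?case
    unfolding Cons.IH by (cases gs; cases hs) (auto simp: All_less_Suc2)
qed auto

end

theory Submission
  imports Defs
begin

text \<open>An isomorphism from \<open>\<Theta>(R)\<close> to a product of staircases assigns to each element a
  vector of exponents bounded by \<open>ks\<close>. Comparing exponents amounts to comparing annihilators,
  so each exponent behaves like a valuation. Suitable idempotents allow the coordinates to be
  chosen independently, whence every ideal has an element whose exponents are all minimal,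
  and this element generates it.
  Conversely, a finite principal ideal ring is a product of finite local rings with principal
  maximal ideals, in which the elements are up to units the powers of a generator. The product
  decomposition is carried out inside the ring by splitting idempotents.\<close>

section \<open>Exponent vectors relative to an idempotent\<close>

text \<open>The idempotent \<open>e\<close> stands for the ring \<open>e R\<close>; the condition \<open>w \<otimes> w' \<otimes> e = e\<close> says
  that \<open>w \<otimes> e\<close> is a unit of that ring.\<close>

locale staircase_valuation = cring R for R (structure) +
  fixes e :: 'a and ks :: "nat list" and v :: "'a \<Rightarrow> nat list"
  assumes e_closed: "e \<in> carrier R"
    and v_bounded: "x \<in> carrier R \<Longrightarrow> list_all2 (\<le>) (v x) ks"
    and v_surj: "list_all2 (\<le>) xs ks \<Longrightarrow> \<exists>x\<in>carrier R. v x = xs"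
    and v_zero_iff: "x \<in> carrier R \<Longrightarrow> y \<in> carrier R \<Longrightarrow>
      x \<otimes> y \<otimes> e = \<zero> \<longleftrightarrow> (\<forall>i<length ks. ks ! i \<le> v x ! i + v y ! i)"
    and v_eq_imp: "x \<in> carrier R \<Longrightarrow> y \<in> carrier R \<Longrightarrow> v x = v y \<Longrightarrow>
      \<exists>w\<in>carrier R. \<exists>w'\<in>carrier R. x \<otimes> e = y \<otimes> w \<otimes> e \<and> w \<otimes> w' \<otimes> e = e"
begin

lemma length_v [simp]: "x \<in> carrier R \<Longrightarrow> length (v x) = length ks"
  using v_bounded list_all2_lengthD by blast

lemma v_le: "x \<in> carrier R \<Longrightarrow> i < length ks \<Longrightarrow> v x ! i \<le> ks ! i"
  using v_bounded by (metis list_all2_conv_all_nth)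

lemma v_nth_surj:
  assumes "\<And>i. i < length ks \<Longrightarrow> f i \<le> ks ! i"
  shows "\<exists>x\<in>carrier R. \<forall>i<length ks. v x ! i = f i"
proof -
  have "list_all2 (\<le>) (map f [0..<length ks]) ks"
    using assms by (simp add: list_all2_conv_all_nth)
  from v_surj[OF this] show ?thesis by force
qed

lemma v_eqI:
  assumes "x \<in> carrier R" "y \<in> carrier R" "\<And>i. i < length ks \<Longrightarrow> v x ! i = v y ! i"
  shows "v x = v y"
  using assms by (simp add: list_eq_iff_nth_eq)

text \<open>By \<open>v_zero_iff\<close>, larger exponents annihilate more. Conversely, one test
  element suffices: its exponents complement those of \<open>x\<close> to \<open>ks\<close>, so that
  it just annihilates \<open>x\<close>.\<close>

lemma v_le_iff_annihilator:
  assumes x: "x \<in> carrier R" and y: "y \<in> carrier R"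
  shows "(\<forall>i<length ks. v x ! i \<le> v y ! i) \<longleftrightarrow>
    (\<forall>z\<in>carrier R. x \<otimes> z \<otimes> e = \<zero> \<longrightarrow> y \<otimes> z \<otimes> e = \<zero>)"
proof
  assume "\<forall>i<length ks. v x ! i \<le> v y ! i"
  then show "\<forall>z\<in>carrier R. x \<otimes> z \<otimes> e = \<zero> \<longrightarrow> y \<otimes> z \<otimes> e = \<zero>"
    using x y by (auto simp: v_zero_iff intro: order_trans add_right_mono)
next
  assume *: "\<forall>z\<in>carrier R. x \<otimes> z \<otimes> e = \<zero> \<longrightarrow> y \<otimes> z \<otimes> e = \<zero>"
  obtain z where z: "z \<in> carrier R" "\<forall>i<length ks. v z ! i = ks ! i - v x ! i"
    using v_nth_surj[of "\<lambda>i. ks ! i - v x ! i"] by auto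
  then have "x \<otimes> z \<otimes> e = \<zero>" using x by (auto simp: v_zero_iff)
  then have "y \<otimes> z \<otimes> e = \<zero>" using * z by blast
  then have "\<forall>i<length ks. ks ! i \<le> v y ! i + (ks ! i - v x ! i)"
    using y z by (simp add: v_zero_iff)
  then show "\<forall>i<length ks. v x ! i \<le> v y ! i"
    using v_le[OF x] by fastforce
qed

end

section \<open>Arithmetic of exponents and generators of ideals\<close>

locale unital_staircase_valuation =
  staircase_valuation R "\<one>\<^bsub>R\<^esub>" ks v for R (structure) and ks v
begin

text \<open>Whatever annihilates \<open>x\<close> annihilates every multiple of
  \<open>x\<close>.\<close>

lemma v_le_mult:
  assumes "x \<in> carrier R" "y \<in> carrier R" "i < length ks"
  shows "v x ! i \<le> v (x \<otimes> y) ! i"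
proof -
  have "x \<otimes> y \<otimes> z \<otimes> \<one> = \<zero>" if "z \<in> carrier R" "x \<otimes> z \<otimes> \<one> = \<zero>" for z
  proof -
    have "x \<otimes> y \<otimes> z \<otimes> \<one> = y \<otimes> (x \<otimes> z \<otimes> \<one>)" using assms that(1) by (simp add: m_ac)
    then show ?thesis using that assms by simp
  qed
  then show ?thesis using v_le_iff_annihilator[of x "x \<otimes> y"] assms by simp
qed

lemma v_uminus:
  assumes "x \<in> carrier R" "i < length ks"
  shows "v (\<ominus> x) ! i = v x ! i"
proof (rule antisym)
  show "v x ! i \<le> v (\<ominus> x) ! i"
    using v_le_mult[of x "\<ominus> \<one>" i] assms by (simp add: r_minus)
  show "v (\<ominus> x) ! i \<le> v x ! i"
    using v_le_mult[of "\<ominus> x" "\<ominus> \<one>" i] assms by (simp add: r_minus)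
qed

text \<open>Whatever annihilates both summands annihilates their sum; the test element
  \<open>z\<close> has the smallest exponents with which it annihilates both.\<close>

lemma v_add_ge:
  assumes x: "x \<in> carrier R" and y: "y \<in> carrier R" and i: "i < length ks"
  shows "min (v x ! i) (v y ! i) \<le> v (x \<oplus> y) ! i"
proof -
  obtain z where z: "z \<in> carrier R"
    "\<forall>i<length ks. v z ! i = ks ! i - min (v x ! i) (v y ! i)"
    using v_nth_surj[of "\<lambda>i. ks ! i - min (v x ! i) (v y ! i)"] by auto
  have "x \<otimes> z \<otimes> \<one> = \<zero>" "y \<otimes> z \<otimes> \<one> = \<zero>"
    unfolding v_zero_iff[OF x z(1)] v_zero_iff[OF y z(1)] using z(2) by auto
  then have "(x \<oplus> y) \<otimes> z \<otimes> \<one> = \<zero>"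
    using x y z by (simp add: l_distr)
  then have "ks ! i \<le> v (x \<oplus> y) ! i + (ks ! i - min (v x ! i) (v y ! i))"
    using v_zero_iff[of "x \<oplus> y" z] x y z i by simp
  moreover have "v x ! i \<le> ks ! i" using v_le x i by simp
  ultimately show ?thesis by linarith
qed

text \<open>The equality case of the ultrametric inequality, from \<open>x = (x + y) - y\<close>.
  Exponents are capped by \<open>ks\<close>, so the second alternative also covers a coordinate in
  which both summands have the maximal exponent.\<close>

lemma v_add_eq:
  assumes x: "x \<in> carrier R" and y: "y \<in> carrier R" and i: "i < length ks"
    and less: "v x ! i < v y ! i \<or> v y ! i = ks ! i"
  shows "v (x \<oplus> y) ! i = v x ! i"
proof (rule antisym)
  have "min (v (x \<oplus> y) ! i) (v (\<ominus> y) ! i) \<le> v (x \<oplus> y \<oplus> \<ominus> y) ! i"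
    using v_add_ge[of "x \<oplus> y" "\<ominus> y" i] x y i by simp
  moreover have "x \<oplus> y \<oplus> \<ominus> y = x" using x y by (simp add: a_assoc r_neg)
  ultimately have "min (v (x \<oplus> y) ! i) (v y ! i) \<le> v x ! i"
    using v_uminus y i by simp
  moreover have "v (x \<oplus> y) ! i \<le> ks ! i" using v_le x y i by simp
  ultimately show "v (x \<oplus> y) ! i \<le> v x ! i" using less by linarith
  have "v x ! i \<le> ks ! i" using v_le x i by simp
  then show "v x ! i \<le> v (x \<oplus> y) ! i"
    using v_add_ge[OF x y i] less by linarith
qed

lemma v_zero: "i < length ks \<Longrightarrow> v \<zero> ! i = ks ! i"
proof -
  assume i: "i < length ks"
  obtain z where z: "z \<in> carrier R" "\<forall>i<length ks. v z ! i = 0"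
    using v_nth_surj[of "\<lambda>_. 0"] by auto
  then show ?thesis using v_zero_iff[of \<zero> z] v_le[of \<zero> i] i by (simp add: le_antisym)
qed

lemma v_one: "i < length ks \<Longrightarrow> v \<one> ! i = 0"
proof -
  assume i: "i < length ks"
  obtain z where z: "z \<in> carrier R" "\<forall>i<length ks. v z ! i = 0"
    using v_nth_surj[of "\<lambda>_. 0"] by auto
  have "\<forall>i<length ks. v \<one> ! i \<le> v z ! i"
    using v_le_iff_annihilator[of \<one> z] z by simp
  then show ?thesis using z i by simp
qed

text \<open>An element with value zero on \<open>S\<close> and maximal value elsewhere and one with the roles
  exchanged sum to a unit; normalising the sum to one lets them select coordinates.\<close>

lemma coordinate_selectors:
  "\<exists>p\<in>carrier R. \<exists>q\<in>carrier R. p \<oplus> q = \<one> \<and>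
    (\<forall>x\<in>carrier R. \<forall>y\<in>carrier R. \<forall>i<length ks.
      v (p \<otimes> x \<oplus> q \<otimes> y) ! i = (if i \<in> S then v x ! i else v y ! i))"
proof -
  obtain a where a: "a \<in> carrier R" "\<forall>i<length ks. v a ! i = (if i \<in> S then 0 else ks ! i)"
    using v_nth_surj[of "\<lambda>i. if i \<in> S then 0 else ks ! i"] by (force split: if_splits)
  obtain b where b: "b \<in> carrier R" "\<forall>i<length ks. v b ! i = (if i \<in> S then ks ! i else 0)"
    using v_nth_surj[of "\<lambda>i. if i \<in> S then ks ! i else 0"] by (force split: if_splits)
  have "v (a \<oplus> b) ! i = 0" if "i < length ks" for i
  proof (cases "i \<in> S")
    case True
    then show ?thesis using v_add_eq[of a b i] a b that by auto
  next
    case False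
    then show ?thesis using v_add_eq[of b a i] a b that by (auto simp: a_comm)
  qed
  then have "v (a \<oplus> b) = v \<one>"
    using a b v_one by (intro v_eqI) auto
  from v_eq_imp[OF _ _ this] obtain w where w: "w \<in> carrier R" "(a \<oplus> b) \<otimes> w = \<one>"
    using a b by auto
  define p where "p = a \<otimes> w"
  define q where "q = b \<otimes> w"
  have p: "p \<in> carrier R" and q: "q \<in> carrier R" using a b w by (auto simp: p_def q_def)
  have pq: "p \<oplus> q = \<one>" using a b w by (simp add: p_def q_def l_distr)
  \<comment> \<open>\<open>p\<close> is a multiple of \<open>a\<close>, so outside \<open>S\<close>
    its multiples keep the maximal exponent; dually for \<open>q\<close> on
    \<open>S\<close>.\<close>
  have vp: "v (p \<otimes> x) ! i = ks ! i" if "i < length ks" "i \<notin> S" "x \<in> carrier R" for i x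
    using v_le_mult[of a "w \<otimes> x" i] v_le[of "p \<otimes> x" i] a w that
    by (simp add: p_def m_assoc)
  have vq: "v (q \<otimes> x) ! i = ks ! i" if "i < length ks" "i \<in> S" "x \<in> carrier R" for i x
    using v_le_mult[of b "w \<otimes> x" i] v_le[of "q \<otimes> x" i] b w that
    by (simp add: q_def m_assoc)
  have split: "p \<otimes> x \<oplus> q \<otimes> x = x" if "x \<in> carrier R" for x
    using l_distr[OF p q that] pq that by simp
  have "v (p \<otimes> x \<oplus> q \<otimes> y) ! i = (if i \<in> S then v x ! i else v y ! i)"
    if x: "x \<in> carrier R" and y: "y \<in> carrier R" and i: "i < length ks" for x y i
  proof (cases "i \<in> S")
    case True
    \<comment> \<open>The exponent at \<open>i\<close> does not depend on \<open>z\<close>; for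
      \<open>z = x\<close> the sum is \<open>x\<close> itself by \<open>split\<close>.\<close>
    have "v (p \<otimes> x \<oplus> q \<otimes> z) ! i = v (p \<otimes> x) ! i" if "z \<in> carrier R" for z
      using v_add_eq[of "p \<otimes> x" "q \<otimes> z" i] vq[OF i True that] p q x that i by simp
    from this[OF x] this[OF y] show ?thesis using True split x by simp
  next
    case False
    have "v (p \<otimes> z \<oplus> q \<otimes> y) ! i = v (q \<otimes> y) ! i" if "z \<in> carrier R" for z
      using v_add_eq[of "q \<otimes> y" "p \<otimes> z" i] vp[OF i False that] p q y that i
      by (simp add: a_comm)
    from this[OF x] this[OF y] show ?thesis using False split y by simp
  qed
  then show ?thesis using p q pq by blast
qed

text \<open>As \<open>v_eq_imp\<close> speaks only of equal exponents, \<open>y\<close> is split as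
  \<open>p y + q y\<close>, and each part is corrected by a multiple of \<open>x\<close> to an
  element with exactly the exponents of \<open>x\<close>.\<close>

lemma factor_of_v_le:
  assumes x: "x \<in> carrier R" and y: "y \<in> carrier R"
    and le: "\<And>i. i < length ks \<Longrightarrow> v x ! i \<le> v y ! i"
  shows "\<exists>z\<in>carrier R. y = x \<otimes> z"
proof -
  obtain p q where p: "p \<in> carrier R" and q: "q \<in> carrier R" and pq: "p \<oplus> q = \<one>"
    and glue: "\<And>a b i. a \<in> carrier R \<Longrightarrow> b \<in> carrier R \<Longrightarrow> i < length ks \<Longrightarrow>
      v (p \<otimes> a \<oplus> q \<otimes> b) ! i = (if v y ! i = v x ! i then v a ! i else v b ! i)"
    using coordinate_selectors[of "{i. v y ! i = v x ! i}"] by auto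
  have "v (p \<otimes> y \<oplus> q \<otimes> x) = v x"
    using p q x y by (intro v_eqI) (auto simp: glue)
  from v_eq_imp[OF _ _ this] obtain w where w: "w \<in> carrier R" "p \<otimes> y \<oplus> q \<otimes> x = x \<otimes> w"
    using p q x y by auto
  \<comment> \<open>Since \<open>q y = p 0 + q y\<close>, the selectors give the maximal exponent
    where \<open>v x\<close> and \<open>v y\<close> agree. Elsewhere the exponent of
    \<open>y\<close> is strictly larger than that of \<open>x\<close>, so one of the alternatives of
    \<open>v_add_eq\<close> always applies.\<close>
  have "v (q \<otimes> y) ! i = (if v y ! i = v x ! i then ks ! i else v y ! i)"
    if "i < length ks" for i
    using glue[of \<zero> y i] that p q y v_zero by simp
  then have "v (x \<oplus> q \<otimes> y) = v x"
    using q x y le by (intro v_eqI v_add_eq) (auto simp: less_le)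
  from v_eq_imp[OF _ _ this] obtain w' where w': "w' \<in> carrier R" "x \<oplus> q \<otimes> y = x \<otimes> w'"
    using q x y by auto
  have "p \<otimes> y = x \<otimes> w \<ominus> q \<otimes> x" "q \<otimes> y = x \<otimes> w' \<ominus> x"
    using w w' p q x y by (simp_all flip: w(2) w'(2) add: minus_eq a_assoc r_neg a_comm[of x] r_neg2)
  then have "p \<otimes> y \<oplus> q \<otimes> y = x \<otimes> (w \<ominus> q) \<oplus> x \<otimes> (w' \<ominus> \<one>)"
    using w w' q x by (simp add: minus_eq r_distr r_minus m_comm)
  moreover have "p \<otimes> y \<oplus> q \<otimes> y = y"
    using l_distr[OF p q y] pq y by simp
  ultimately have "y = x \<otimes> ((w \<ominus> q) \<oplus> (w' \<ominus> \<one>))"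
    using w w' q x by (simp add: r_distr)
  then show ?thesis using w w' q by blast
qed

text \<open>An element of the ideal with the least sum of exponents is minimal in every coordinate,
  since otherwise the selectors would glue a better one. Hence it divides the whole ideal.\<close>

theorem principal_ideal_ring: "principal_ideal_ring R"
proof (intro principal_ideal_ring.intro principal_ideal_ring_axioms.intro principalidealI)
  fix I assume I: "ideal I R"
  interpret I: ideal I R by (rule I)
  have "\<zero> \<in> I" by simp
  then obtain x where x: "x \<in> I" and
    min: "\<And>y. y \<in> I \<Longrightarrow> sum_list (v x) \<le> sum_list (v y)"
    using ex_has_least_nat[of "\<lambda>x. x \<in> I" \<zero> "\<lambda>x. sum_list (v x)"] by blast
  have xR: "x \<in> carrier R" using x I.Icarr by blast
  have "v x ! i \<le> v y ! i" if y: "y \<in> I" and i: "i < length ks" for y i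
  proof (rule ccontr)
    assume less: "\<not> v x ! i \<le> v y ! i"
    have yR: "y \<in> carrier R" using y I.Icarr by blast
    obtain p q where p: "p \<in> carrier R" and q: "q \<in> carrier R"
      and glue: "\<And>a b i. a \<in> carrier R \<Longrightarrow> b \<in> carrier R \<Longrightarrow> i < length ks \<Longrightarrow>
        v (p \<otimes> a \<oplus> q \<otimes> b) ! i = (if v x ! i \<le> v y ! i then v a ! i else v b ! i)"
      using coordinate_selectors[of "{i. v x ! i \<le> v y ! i}"] by auto
    \<comment> \<open>This element of \<open>I\<close> has the coordinatewise minimum of the
      exponents of \<open>x\<close> and \<open>y\<close>.\<close>
    let ?z = "p \<otimes> x \<oplus> q \<otimes> y"
    have z: "?z \<in> I" using x y p q by (simp add: I.I_l_closed)
    have "sum_list (v ?z) = (\<Sum>j<length ks. v ?z ! j)"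
      using p q xR yR by (simp add: sum_list_sum_nth atLeast0LessThan)
    also have "\<dots> < (\<Sum>j<length ks. v x ! j)"
      using i less xR yR by (intro sum_strict_mono_ex1) (auto simp: glue)
    also have "\<dots> = sum_list (v x)"
      using xR by (simp add: sum_list_sum_nth atLeast0LessThan)
    finally show False using min[OF z] by simp
  qed
  then have "\<exists>z\<in>carrier R. y = x \<otimes> z" if "y \<in> I" for y
    using factor_of_v_le[OF xR I.Icarr] that by blast
  then have "I = PIdl x"
    using x I.I_l_closed xR by (fastforce simp: cgenideal_def m_comm)
  then have "I = Idl {x}" using cgenideal_eq_genideal[OF xR] by simp
  then show "\<exists>i\<in>carrier R. I = Idl {i}" using xR by blast
qed (simp_all add: is_cring)

end

section \<open>Gluing along orthogonal idempotents\<close>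

text \<open>Annihilation in \<open>e R\<close> depends only on the image
  \<open>x \<otimes> e\<close>. This allows an element to be replaced by one with the same component
  when two valuations are glued.\<close>

lemma (in staircase_valuation) v_cong:
  assumes x: "x \<in> carrier R" and y: "y \<in> carrier R" and eq: "x \<otimes> e = y \<otimes> e"
  shows "v x = v y"
proof -
  have "a \<otimes> z \<otimes> e = a \<otimes> e \<otimes> z" if "a \<in> carrier R" "z \<in> carrier R" for a z
    using that e_closed by (simp add: m_ac)
  then have "x \<otimes> z \<otimes> e = y \<otimes> z \<otimes> e" if "z \<in> carrier R" for z
    using that x y eq by simp
  then show ?thesis
    using v_le_iff_annihilator[OF x y] v_le_iff_annihilator[OF y x] x y
    by (intro v_eqI antisym) auto
qed

context cring
begin

text \<open>The idempotent zero stands for the zero ring, which corresponds to the empty product of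
  graphs.\<close>

lemma staircase_valuation_zero: "staircase_valuation R \<zero> [] (\<lambda>_. [])"
  by unfold_locales auto

text \<open>For orthogonal \<open>f\<close> and \<open>g\<close>, the ring \<open>(f + g) R\<close>
  is the product of \<open>f R\<close> and \<open>g R\<close>, so exponent vectors are concatenated.
  An element with components \<open>a\<close> and \<open>b\<close> is
  \<open>a f + b g\<close>.\<close>

lemma staircase_valuation_add:
  assumes f: "f \<in> carrier R" "f \<otimes> f = f" and g: "g \<in> carrier R" "g \<otimes> g = g"
    and fg: "f \<otimes> g = \<zero>"
    and vf: "staircase_valuation R f ks v" and ug: "staircase_valuation R g ls u"
  shows "staircase_valuation R (f \<oplus> g) (ks @ ls) (\<lambda>x. v x @ u x)"
proof -
  interpret F: staircase_valuation R f ks v by (rule vf)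
  interpret G: staircase_valuation R g ls u by (rule ug)
  have gf: "g \<otimes> f = \<zero>" using fg f g by (simp add: m_comm)
  have proj: "(x \<otimes> f \<oplus> y \<otimes> g) \<otimes> f = x \<otimes> f" "(x \<otimes> f \<oplus> y \<otimes> g) \<otimes> g = y \<otimes> g"
    if "x \<in> carrier R" "y \<in> carrier R" for x y
    using that f g fg gf by (simp_all add: l_distr m_assoc)
  show ?thesis
  proof unfold_locales
    show "f \<oplus> g \<in> carrier R" using f g by simp
    show "list_all2 (\<le>) (v x @ u x) (ks @ ls)" if "x \<in> carrier R" for x
      using F.v_bounded[OF that] G.v_bounded[OF that] by (rule list_all2_appendI)
    show "\<exists>x\<in>carrier R. v x @ u x = xs" if le: "list_all2 (\<le>) xs (ks @ ls)" for xs
    proof -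
      obtain as bs where xs: "xs = as @ bs" "list_all2 (\<le>) as ks" "list_all2 (\<le>) bs ls"
        using le[unfolded list_all2_append2] by blast
      obtain a b where a: "a \<in> carrier R" "v a = as" and b: "b \<in> carrier R" "u b = bs"
        using F.v_surj G.v_surj xs by blast
      have "v (a \<otimes> f \<oplus> b \<otimes> g) = v a" "u (a \<otimes> f \<oplus> b \<otimes> g) = u b"
        using a b f g proj by (auto intro!: F.v_cong G.v_cong)
      then show ?thesis using a b f g xs by (intro bexI[of _ "a \<otimes> f \<oplus> b \<otimes> g"]) auto
    qed
    show "x \<otimes> y \<otimes> (f \<oplus> g) = \<zero> \<longleftrightarrow>
        (\<forall>i<length (ks @ ls). (ks @ ls) ! i \<le> (v x @ u x) ! i + (v y @ u y) ! i)"
      if x: "x \<in> carrier R" and y: "y \<in> carrier R" for x y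
    proof -
      let ?s = "x \<otimes> y \<otimes> (f \<oplus> g)"
      \<comment> \<open>With the coordinatewise sums written as lists,
        \<open>list_all2_append\<close> splits the condition without any shift of indices.\<close>
      have sums: "map2 (+) (v x) (v y) @ map2 (+) (u x) (u y) = map2 (+) (v x @ u x) (v y @ u y)"
        using x y by simp
      have s: "?s = x \<otimes> y \<otimes> f \<oplus> x \<otimes> y \<otimes> g" using x y f g by (simp add: r_distr)
      have "x \<otimes> y \<otimes> f = ?s \<otimes> f" "x \<otimes> y \<otimes> g = ?s \<otimes> g"
        unfolding s using proj[of "x \<otimes> y" "x \<otimes> y"] x y by simp_all
      then have "?s = \<zero> \<longleftrightarrow> x \<otimes> y \<otimes> f = \<zero> \<and> x \<otimes> y \<otimes> g = \<zero>"
        using s f g by (metis l_null r_zero zero_closed)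
      also have "\<dots> \<longleftrightarrow> (\<forall>i<length ks. ks ! i \<le> v x ! i + v y ! i) \<and>
          (\<forall>i<length ls. ls ! i \<le> u x ! i + u y ! i)"
        using x y by (simp add: F.v_zero_iff G.v_zero_iff)
      also have "\<dots> \<longleftrightarrow>
          list_all2 (\<le>) (ks @ ls) (map2 (+) (v x) (v y) @ map2 (+) (u x) (u y))"
        using x y by (subst list_all2_append) (simp_all add: list_all2_conv_all_nth)
      also have "\<dots> \<longleftrightarrow> list_all2 (\<le>) (ks @ ls) (map2 (+) (v x @ u x) (v y @ u y))"
        by (simp only: sums)
      also have "\<dots> \<longleftrightarrow>
          (\<forall>i<length (ks @ ls). (ks @ ls) ! i \<le> (v x @ u x) ! i + (v y @ u y) ! i)"
        using x y by (simp add: list_all2_conv_all_nth del: zip_append map_append)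
      finally show ?thesis .
    qed
    show "\<exists>w\<in>carrier R. \<exists>w'\<in>carrier R.
        x \<otimes> (f \<oplus> g) = y \<otimes> w \<otimes> (f \<oplus> g) \<and> w \<otimes> w' \<otimes> (f \<oplus> g) = f \<oplus> g"
      if x: "x \<in> carrier R" and y: "y \<in> carrier R" and eq: "v x @ u x = v y @ u y" for x y
    proof -
      have "v x = v y" "u x = u y" using eq x y by simp_all
      then obtain w w' z z' where w: "w \<in> carrier R" "w' \<in> carrier R"
          "x \<otimes> f = y \<otimes> w \<otimes> f" "w \<otimes> w' \<otimes> f = f"
        and z: "z \<in> carrier R" "z' \<in> carrier R" "x \<otimes> g = y \<otimes> z \<otimes> g" "z \<otimes> z' \<otimes> g = g"
        using F.v_eq_imp[OF x y] G.v_eq_imp[OF x y] by blast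
      \<comment> \<open>The unit factors of the two components are glued. The fact
        \<open>mult\<close> is used for \<open>a = y\<close> and for \<open>a = ?w'\<close>.\<close>
      let ?w = "w \<otimes> f \<oplus> z \<otimes> g" and ?w' = "w' \<otimes> f \<oplus> z' \<otimes> g"
      have mult: "a \<otimes> ?w \<otimes> (f \<oplus> g) = a \<otimes> w \<otimes> f \<oplus> a \<otimes> z \<otimes> g" if "a \<in> carrier R" for a
      proof -
        have "a \<otimes> b \<otimes> (f \<oplus> g) = a \<otimes> (b \<otimes> f) \<oplus> a \<otimes> (b \<otimes> g)" if "b \<in> carrier R" for b
          using \<open>a \<in> carrier R\<close> that f(1) g(1) by (simp add: r_distr m_assoc)
        from this[of ?w]
        have "a \<otimes> ?w \<otimes> (f \<oplus> g) = a \<otimes> (?w \<otimes> f) \<oplus> a \<otimes> (?w \<otimes> g)"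
          using w z f g by simp
        then show ?thesis using that w z f g proj[of w z] by (simp add: m_assoc)
      qed
      have 1: "x \<otimes> (f \<oplus> g) = y \<otimes> ?w \<otimes> (f \<oplus> g)"
        using w z x y f g mult[OF y] by (simp add: r_distr)
      have "?w' \<otimes> w \<otimes> f = w \<otimes> (?w' \<otimes> f)" "?w' \<otimes> z \<otimes> g = z \<otimes> (?w' \<otimes> g)"
        using w z f g by (simp_all add: m_ac)
      then have "?w' \<otimes> w \<otimes> f = f" "?w' \<otimes> z \<otimes> g = g"
        using proj[of w' z'] w z f g by (simp_all add: m_assoc)
      then have "?w' \<otimes> ?w \<otimes> (f \<oplus> g) = f \<oplus> g"
        using mult[of ?w'] w z f g by simp
      moreover have "?w' \<otimes> ?w = ?w \<otimes> ?w'" by (rule m_comm) (use w z f g in auto)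
      ultimately have 2: "?w \<otimes> ?w' \<otimes> (f \<oplus> g) = f \<oplus> g" by simp
      have "?w \<in> carrier R" "?w' \<in> carrier R" using w z f g by auto
      with 1 2 show ?thesis by blast
    qed
  qed
qed

section \<open>Idempotents and local factors of finite principal ideal rings\<close>

text \<open>In a finite ring the powers of \<open>x\<close> are eventually periodic, and a large
  enough multiple of the period is an idempotent exponent. Positivity makes the idempotent a
  multiple of \<open>x\<close>.\<close>

lemma nat_pow_idempotent_exists:
  assumes fin: "finite (carrier R)" and x: "x \<in> carrier R"
  shows "\<exists>n::nat. n > 0 \<and> x [^] n \<otimes> x [^] n = x [^] n"
proof -
  have "finite (range (\<lambda>n::nat. x [^] n))"
    using fin by (rule finite_subset[rotated]) (use x in auto)
  then have "\<not> inj (\<lambda>n::nat. x [^] n)"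
    using finite_imageD infinite_UNIV_nat by blast
  then obtain i j :: nat where ij: "i < j" "x [^] i = x [^] j"
    unfolding inj_def by (metis linorder_neqE_nat)
  define d where "d = j - i"
  have d: "d > 0" and step: "x [^] (i + d) = x [^] i" using ij by (auto simp: d_def)
  have periodic: "x [^] (i + m + t * d) = x [^] (i + m)" for m t :: nat
  proof (induction t)
    case (Suc t)
    have "x [^] (i + m + Suc t * d) = x [^] (i + d) \<otimes> x [^] (m + t * d)"
      using x by (simp add: nat_pow_mult algebra_simps)
    also have "\<dots> = x [^] i \<otimes> x [^] (m + t * d)" by (simp only: step)
    also have "\<dots> = x [^] (i + m + t * d)" using x by (simp add: nat_pow_mult add.assoc)
    finally show ?case using Suc by simp
  qed simp
  \<comment> \<open>A multiple of the period \<open>d\<close> that is at least \<open>i\<close>;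
    \<open>Suc\<close> keeps it positive for \<open>i = 0\<close>.\<close>
  define n where "n = Suc i * d"
  have "i \<le> n" using d by (cases d) (auto simp: n_def)
  then have "x [^] (n + n) = x [^] n"
    using periodic[of "n - i" "Suc i"] by (simp add: n_def)
  then have "x [^] n \<otimes> x [^] n = x [^] n" using x by (simp add: nat_pow_mult)
  moreover have "n > 0" using d by (simp add: n_def)
  ultimately show ?thesis by blast
qed

end

text \<open>Here \<open>e R\<close> is a finite local ring with nilpotent maximal ideal \<open>(p)\<close>, so up to a unit each
  of its elements is a power of \<open>p\<close>.\<close>

lemma (in principal_ideal_ring) staircase_valuation_primitive_idempotent:
  assumes fin: "finite (carrier R)" and e: "e \<in> carrier R" "e \<otimes> e = e" "e \<noteq> \<zero>"
    and primitive: "\<And>f. f \<in> carrier R \<Longrightarrow> f \<otimes> f = f \<Longrightarrow> f \<otimes> e = f \<Longrightarrow> f = \<zero> \<or> f = e"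
  shows "\<exists>k v. staircase_valuation R e [k] v"
proof -
  \<comment> \<open>The elements with nilpotent image in \<open>e R\<close>, that is, the preimage
    of its maximal ideal. Taken inside \<open>R\<close>, so that \<open>principal\<close> applies to
    it.\<close>
  define N where "N = {x \<in> carrier R. \<exists>n::nat. x [^] n \<otimes> e = \<zero>}"
  have NR: "N \<subseteq> carrier R" by (auto simp: N_def)
  \<comment> \<open>An idempotent power of \<open>x\<close>, multiplied by \<open>e\<close>, is
    nonzero for \<open>x\<close> outside \<open>N\<close>; primitivity makes it equal to
    \<open>e\<close>.\<close>
  have unit: "\<exists>w\<in>carrier R. x \<otimes> w \<otimes> e = e" if x: "x \<in> carrier R" "x \<notin> N" for x
  proof -
    obtain n :: nat where n: "n > 0" "x [^] n \<otimes> x [^] n = x [^] n"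
      using nat_pow_idempotent_exists[OF fin x(1)] by blast
    let ?f = "x [^] n \<otimes> e"
    have "?f \<otimes> ?f = (x [^] n \<otimes> x [^] n) \<otimes> (e \<otimes> e)" using x e(1) by (simp add: m_ac)
    then have "?f \<otimes> ?f = ?f" using n e by simp
    moreover have "?f \<otimes> e = ?f" using x e by (simp add: m_assoc)
    moreover have "?f \<noteq> \<zero>" using x by (auto simp: N_def)
    ultimately have "?f = e" using primitive[of ?f] x e by auto
    moreover have "x [^] n = x \<otimes> x [^] (n - 1)"
      using n x nat_pow_Suc2[of x "n - 1"] by simp
    ultimately show ?thesis using x by (intro bexI[of _ "x [^] (n - 1)"]) auto
  qed
  have not_unit: "x \<otimes> w \<otimes> e \<noteq> e" if x: "x \<in> N" and w: "w \<in> carrier R" for x w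
  proof
    assume eq: "x \<otimes> w \<otimes> e = e"
    have xR: "x \<in> carrier R" using x NR by blast
    have "(x \<otimes> w) [^] n \<otimes> e = e" for n :: nat
      by (induction n) (use eq xR w e in \<open>auto simp: m_assoc\<close>)
    then have "x [^] n \<otimes> e \<otimes> w [^] n = e" for n :: nat
      using xR w e(1) by (simp add: nat_pow_distrib m_ac)
    moreover obtain n :: nat where "x [^] n \<otimes> e = \<zero>" using x by (auto simp: N_def)
    ultimately have "\<zero> \<otimes> w [^] n = e" by metis
    then show False using w e by simp
  qed
  have N_mult: "x \<otimes> y \<in> N" if x: "x \<in> N" and y: "y \<in> carrier R" for x y
  proof -
    obtain n :: nat where n: "x [^] n \<otimes> e = \<zero>" and xR: "x \<in> carrier R"
      using x by (auto simp: N_def)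
    have "(x \<otimes> y) [^] n \<otimes> e = x [^] n \<otimes> e \<otimes> y [^] n"
      using xR y e(1) by (simp add: nat_pow_distrib m_ac)
    then show ?thesis using n xR y by (auto simp: N_def)
  qed
  have N_add: "x \<oplus> y \<in> N" if x: "x \<in> N" and y: "y \<in> N" for x y
  proof (rule ccontr)
    assume "x \<oplus> y \<notin> N"
    have xy: "x \<in> carrier R" "y \<in> carrier R" using x y NR by auto
    then obtain w where w: "w \<in> carrier R" "(x \<oplus> y) \<otimes> w \<otimes> e = e"
      using unit[of "x \<oplus> y"] \<open>x \<oplus> y \<notin> N\<close> by auto
    define a where "a = x \<otimes> (w \<otimes> e)"
    define b where "b = y \<otimes> (w \<otimes> e)"
    have a: "a \<in> N" and b: "b \<in> N" using x y w e N_mult by (auto simp: a_def b_def)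
    then have abR: "a \<in> carrier R" "b \<in> carrier R" using NR by auto
    have ab: "a \<oplus> b = e" using w xy e by (simp add: a_def b_def l_distr m_assoc)
    \<comment> \<open>As \<open>b = e - a\<close>, the witness \<open>c\<close> is the geometric sum
      \<open>e + a + ... + a^(n-1)\<close> with \<open>n\<close> terms. Nilpotence of
      \<open>a\<close> then makes \<open>b\<close> a unit of \<open>e R\<close>, contradicting
      \<open>not_unit\<close>.\<close>
    have geometric: "\<exists>c\<in>carrier R. b \<otimes> c \<oplus> a [^] n \<otimes> e = e" for n :: nat
    proof (induction n)
      case 0
      then show ?case using abR e by (intro bexI[of _ \<zero>]) auto
    next
      case (Suc n)
      then obtain c where c: "c \<in> carrier R" "b \<otimes> c \<oplus> a [^] n \<otimes> e = e" by blast
      have "a [^] n \<otimes> e = a [^] n \<otimes> e \<otimes> (a \<oplus> b)" using abR e ab by (simp add: m_assoc)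
      also have "\<dots> = b \<otimes> (a [^] n \<otimes> e) \<oplus> a [^] Suc n \<otimes> e"
        using abR e(1) by (simp add: r_distr m_ac a_comm)
      finally have "b \<otimes> (c \<oplus> a [^] n \<otimes> e) \<oplus> a [^] Suc n \<otimes> e = e"
        using c abR e(1) by (simp add: r_distr a_assoc del: nat_pow_Suc)
      then show ?case using c abR e by blast
    qed
    obtain n :: nat where "a [^] n \<otimes> e = \<zero>" using a by (auto simp: N_def)
    then obtain c where "c \<in> carrier R" "b \<otimes> c = e" using geometric[of n] abR by auto
    then show False using not_unit[OF b, of c] e by simp
  qed
  have "ideal N R"
  proof (rule idealI)
    show "ring R" by (rule ring_axioms)
    show "subgroup N (add_monoid R)"
    proof (rule add.subgroupI)
      show "N \<subseteq> carrier R" by (rule NR)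
      have "\<zero> [^] (1::nat) \<otimes> e = \<zero>" using e by simp
      then have "\<zero> \<in> N" unfolding N_def by blast
      then show "N \<noteq> {}" by blast
      show "\<ominus> x \<in> N" if "x \<in> N" for x
        using N_mult[OF that, of "\<ominus> \<one>"] that NR by (auto simp: r_minus)
      show "x \<oplus> y \<in> N" if "x \<in> N" "y \<in> N" for x y using N_add that .
    qed
    show "x \<otimes> a \<in> N" "a \<otimes> x \<in> N" if "a \<in> N" "x \<in> carrier R" for a x
      using N_mult[OF that] that NR by (auto simp: m_comm)
  qed
  then obtain p where p: "p \<in> carrier R" "N = PIdl p"
    using principalideal.generate[OF principal] cgenideal_eq_genideal by metis
  have "p \<in> N" using p cgenideal_self by simp
  then obtain n :: nat where n: "p [^] n \<otimes> e = \<zero>" by (auto simp: N_def)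
  \<comment> \<open>The nilpotency index of \<open>p\<close> in \<open>e R\<close>, which becomes
    the index of the staircase.\<close>
  define k where "k = (LEAST k::nat. p [^] k \<otimes> e = \<zero>)"
  have k: "p [^] k \<otimes> e = \<zero>" unfolding k_def using n by (rule LeastI)
  have zero_iff: "p [^] j \<otimes> e = \<zero> \<longleftrightarrow> k \<le> j" for j :: nat
  proof
    show "p [^] j \<otimes> e = \<zero> \<Longrightarrow> k \<le> j" unfolding k_def by (rule Least_le)
    assume "k \<le> j"
    then have "p [^] j \<otimes> e = p [^] (j - k) \<otimes> (p [^] k \<otimes> e)"
      using p e(1) by (simp add: nat_pow_mult flip: m_assoc)
    then show "p [^] j \<otimes> e = \<zero>" using k p by simp
  qed
  define rep where "rep x i \<longleftrightarrow> (\<exists>w\<in>carrier R. \<exists>w'\<in>carrier R.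
    x \<otimes> e = p [^] (i::nat) \<otimes> w \<otimes> e \<and> w \<otimes> w' \<otimes> e = e)" for x i
  have "\<exists>i\<le>k. rep x i" if x: "x \<in> carrier R" for x
  proof -
    \<comment> \<open>Factors \<open>p\<close> are pulled out of \<open>x\<close> until the cofactor
      leaves \<open>N\<close> and is therefore a unit of \<open>e R\<close>.\<close>
    have "(\<exists>i<j. rep x i) \<or> (\<exists>w\<in>carrier R. x \<otimes> e = p [^] j \<otimes> w \<otimes> e)" for j
    proof (induction j)
      case 0
      then show ?case using x by (auto intro!: bexI[of _ x])
    next
      case (Suc j)
      then consider i where "i < j" "rep x i"
        | w where "w \<in> carrier R" "x \<otimes> e = p [^] j \<otimes> w \<otimes> e" by blast
      then show ?case
      proof cases
        case 1
        then show ?thesis using less_SucI by blast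
      next
        case (2 w)
        show ?thesis
        proof (cases "w \<in> N")
          case True
          then obtain y where y: "y \<in> carrier R" "w = y \<otimes> p"
            using p by (auto simp: cgenideal_def)
          then have "x \<otimes> e = p [^] Suc j \<otimes> y \<otimes> e" using 2 p by (simp add: m_ac)
          then show ?thesis using y by blast
        next
          case False
          then have "rep x j" using 2 unit[of w] unfolding rep_def by blast
          then show ?thesis by blast
        qed
      qed
    qed
    from this[of k] show ?thesis
    proof
      assume "\<exists>w\<in>carrier R. x \<otimes> e = p [^] k \<otimes> w \<otimes> e"
      then obtain w where w: "w \<in> carrier R" "x \<otimes> e = p [^] k \<otimes> w \<otimes> e" by blast
      have "p [^] k \<otimes> w \<otimes> e = w \<otimes> (p [^] k \<otimes> e)" using w p e(1) by (simp add: m_ac)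
      \<comment> \<open>Here \<open>x\<close> vanishes in \<open>e R\<close>, as does
        \<open>p [^] k\<close>, so the cofactor may be replaced by the unit one.\<close>
      then have "x \<otimes> e = p [^] k \<otimes> \<one> \<otimes> e" using w p k by simp
      moreover have "\<one> \<otimes> \<one> \<otimes> e = e" using e by simp
      ultimately have "rep x k" unfolding rep_def by blast
      then show ?thesis by blast
    qed (meson less_imp_le)
  qed
  then obtain \<mu> where \<mu>: "\<mu> x \<le> k" "rep x (\<mu> x)" if "x \<in> carrier R" for x by metis
  have \<mu>_zero_iff: "x \<otimes> y \<otimes> e = \<zero> \<longleftrightarrow> k \<le> \<mu> x + \<mu> y"
    if x: "x \<in> carrier R" and y: "y \<in> carrier R" for x y
  proof -
    obtain w w' z z' where w: "w \<in> carrier R" "w' \<in> carrier R"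
        "x \<otimes> e = p [^] \<mu> x \<otimes> w \<otimes> e" "w \<otimes> w' \<otimes> e = e"
      and z: "z \<in> carrier R" "z' \<in> carrier R"
        "y \<otimes> e = p [^] \<mu> y \<otimes> z \<otimes> e" "z \<otimes> z' \<otimes> e = e"
      using \<mu>(2)[OF x] \<mu>(2)[OF y] unfolding rep_def by blast
    have "x \<otimes> y \<otimes> e = (x \<otimes> e) \<otimes> (y \<otimes> e)"
    proof -
      have "(x \<otimes> e) \<otimes> (y \<otimes> e) = x \<otimes> y \<otimes> (e \<otimes> e)" using x y e(1) by (simp add: m_ac)
      then show ?thesis using e by simp
    qed
    also have "\<dots> = (p [^] \<mu> x \<otimes> p [^] \<mu> y \<otimes> (e \<otimes> e)) \<otimes> (w \<otimes> z)"
      unfolding w(3) z(3) using w(1) z(1) p e(1) by (simp add: m_ac)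
    finally have xy: "x \<otimes> y \<otimes> e = p [^] (\<mu> x + \<mu> y) \<otimes> e \<otimes> (w \<otimes> z)"
      using p e by (simp add: nat_pow_mult)
    \<comment> \<open>The inverses \<open>w'\<close> and \<open>z'\<close> recover the power of
      \<open>p\<close> from \<open>x y\<close>, so both vanish together.\<close>
    have "p [^] (\<mu> x + \<mu> y) \<otimes> e = p [^] (\<mu> x + \<mu> y) \<otimes> ((w \<otimes> w' \<otimes> e) \<otimes> (z \<otimes> z' \<otimes> e))"
      using w z e by simp
    also have "\<dots> = p [^] (\<mu> x + \<mu> y) \<otimes> (e \<otimes> e) \<otimes> (w \<otimes> z) \<otimes> (w' \<otimes> z')"
      using w(1,2) z(1,2) p e(1) by (simp add: m_ac)
    also have "\<dots> = x \<otimes> y \<otimes> e \<otimes> (w' \<otimes> z')" using e by (simp add: xy)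
    finally have "x \<otimes> y \<otimes> e = \<zero> \<longleftrightarrow> p [^] (\<mu> x + \<mu> y) \<otimes> e = \<zero>"
      using xy w z by auto
    then show ?thesis by (simp add: zero_iff)
  qed
  have \<mu>_pow: "\<mu> (p [^] i) = i" if i: "i \<le> k" for i
  proof -
    obtain w w' where w: "w \<in> carrier R" "w' \<in> carrier R"
        "p [^] i \<otimes> e = p [^] \<mu> (p [^] i) \<otimes> w \<otimes> e" "w \<otimes> w' \<otimes> e = e"
      using \<mu>(2)[of "p [^] i"] p unfolding rep_def by auto
    let ?m = "\<mu> (p [^] i)"
    \<comment> \<open>The powers with exponents \<open>i\<close> and \<open>?m\<close> differ by a
      unit of \<open>e R\<close>, so multiplication by \<open>p [^] j\<close> annihilates both or
      neither. The choices \<open>j = k - i\<close> and \<open>j = k - ?m\<close> give the two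
      inequalities.\<close>
    have shift: "p [^] (i + j) \<otimes> e = p [^] (?m + j) \<otimes> e \<otimes> w" for j
    proof -
      have "p [^] (i + j) \<otimes> e = p [^] j \<otimes> (p [^] i \<otimes> e)"
        using p e(1) by (simp add: m_ac flip: nat_pow_mult)
      also have "\<dots> = p [^] (?m + j) \<otimes> e \<otimes> w"
        unfolding w(3) using p e(1) w(1) by (simp add: m_ac flip: nat_pow_mult)
      finally show ?thesis .
    qed
    have "p [^] (?m + j) \<otimes> e = p [^] (i + j) \<otimes> e \<otimes> w'" for j
    proof -
      have "p [^] (i + j) \<otimes> e \<otimes> w' = p [^] (?m + j) \<otimes> (w \<otimes> w' \<otimes> e)"
        unfolding shift using p e(1) w(1,2) by (simp add: m_ac)
      then show ?thesis using w by simp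
    qed
    then have "k \<le> ?m + j \<longleftrightarrow> k \<le> i + j" for j
      using shift[of j] w by (simp flip: zero_iff) (metis l_null)
    from this[of "k - i"] this[of "k - ?m"] show ?thesis
      using i \<mu>(1)[of "p [^] i"] p by simp
  qed
  have "staircase_valuation R e [k] (\<lambda>x. [\<mu> x])"
  proof unfold_locales
    show "\<exists>x\<in>carrier R. [\<mu> x] = xs" if le: "list_all2 (\<le>) xs [k]" for xs
    proof -
      obtain i where "xs = [i]" "i \<le> k" using le by (auto simp: list_all2_Cons2)
      then show ?thesis using \<mu>_pow p by (intro bexI[of _ "p [^] i"]) auto
    qed
    show "\<exists>w\<in>carrier R. \<exists>w'\<in>carrier R. x \<otimes> e = y \<otimes> w \<otimes> e \<and> w \<otimes> w' \<otimes> e = e"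
      if x: "x \<in> carrier R" and y: "y \<in> carrier R" and eq: "[\<mu> x] = [\<mu> y]" for x y
    proof -
      obtain w w' z z' where w: "w \<in> carrier R" "w' \<in> carrier R"
          "x \<otimes> e = p [^] \<mu> y \<otimes> w \<otimes> e" "w \<otimes> w' \<otimes> e = e"
        and z: "z \<in> carrier R" "z' \<in> carrier R"
          "y \<otimes> e = p [^] \<mu> y \<otimes> z \<otimes> e" "z \<otimes> z' \<otimes> e = e"
        using \<mu>(2)[OF x] \<mu>(2)[OF y] eq unfolding rep_def by force
      \<comment> \<open>\<open>x\<close> and \<open>y\<close> are the same power of \<open>p\<close>
        times the units \<open>w\<close> and \<open>z\<close>; their quotient is
        \<open>z' w\<close>, with inverse \<open>z w'\<close>.\<close>
      have "y \<otimes> (z' \<otimes> w) \<otimes> e = (y \<otimes> e) \<otimes> (z' \<otimes> w)"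
        using y w(1) z(2) e(1) by (simp add: m_ac)
      also have "\<dots> = p [^] \<mu> y \<otimes> w \<otimes> (z \<otimes> z' \<otimes> e)"
        unfolding z(3) using p w(1) z(1,2) e(1) by (simp add: m_ac)
      finally have 1: "x \<otimes> e = y \<otimes> (z' \<otimes> w) \<otimes> e" using w z by simp
      have "(z' \<otimes> w) \<otimes> (z \<otimes> w') \<otimes> e = (z \<otimes> z') \<otimes> (w \<otimes> w' \<otimes> e)"
        using w(1,2) z(1,2) e(1) by (simp add: m_ac)
      then have 2: "(z' \<otimes> w) \<otimes> (z \<otimes> w') \<otimes> e = e" using w z by simp
      have "z' \<otimes> w \<in> carrier R" "z \<otimes> w' \<in> carrier R" using w z by auto
      with 1 2 show ?thesis by blast
    qed
  qed (use e \<mu> \<mu>_zero_iff in auto)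
  then show ?thesis by blast
qed

text \<open>Induction on the size of \<open>e R\<close>: if \<open>e\<close> is neither zero nor
  primitive, it is the sum of two orthogonal idempotents \<open>f\<close> and \<open>e - f\<close>,
  both of which generate smaller rings.\<close>

lemma (in principal_ideal_ring) staircase_valuation_idempotent:
  assumes fin: "finite (carrier R)" and "e \<in> carrier R" "e \<otimes> e = e"
  shows "\<exists>ks v. staircase_valuation R e ks v"
  using assms(2,3)
proof (induction "card ((\<lambda>x. x \<otimes> e) ` carrier R)" arbitrary: e rule: less_induct)
  case less
  note e = less.prems
  have smaller: "\<exists>ks v. staircase_valuation R f ks v"
    if f: "f \<in> carrier R" "f \<otimes> f = f" "f \<otimes> e = f" "f \<noteq> e" for f
  proof (rule less.hyps)
    have "x \<otimes> f = x \<otimes> f \<otimes> e" if "x \<in> carrier R" for x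
      using that f e by (simp add: m_assoc)
    then have "(\<lambda>x. x \<otimes> f) ` carrier R \<subseteq> (\<lambda>x. x \<otimes> e) ` carrier R"
      using f(1) by fastforce
    moreover have "e \<in> (\<lambda>x. x \<otimes> e) ` carrier R" using e by force
    moreover have "e \<notin> (\<lambda>x. x \<otimes> f) ` carrier R"
    proof
      assume "e \<in> (\<lambda>x. x \<otimes> f) ` carrier R"
      then obtain x where x: "x \<in> carrier R" "e = x \<otimes> f" by blast
      then have "e \<otimes> f = e" using f by (simp add: m_assoc)
      then show False using f e by (simp add: m_comm)
    qed
    ultimately show "card ((\<lambda>x. x \<otimes> f) ` carrier R) < card ((\<lambda>x. x \<otimes> e) ` carrier R)"
      using fin by (intro psubset_card_mono) auto
  qed (use f in auto)
  consider "e = \<zero>"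
    | f where "f \<in> carrier R" "f \<otimes> f = f" "f \<otimes> e = f" "f \<noteq> \<zero>" "f \<noteq> e"
    | "e \<noteq> \<zero>" "\<And>f. f \<in> carrier R \<Longrightarrow> f \<otimes> f = f \<Longrightarrow> f \<otimes> e = f \<Longrightarrow> f = \<zero> \<or> f = e"
    by blast
  then show ?case
  proof cases
    case 1
    then show ?thesis using staircase_valuation_zero by blast
  next
    case (2 f)
    define g where "g = e \<ominus> f"
    have ef: "e \<otimes> f = f" using 2 e by (simp add: m_comm)
    have gR: "g \<in> carrier R" using 2 e by (simp add: g_def)
    have fg: "f \<otimes> g = \<zero>" using 2 e by (simp add: g_def minus_eq r_distr r_minus r_neg)
    have ge: "g \<otimes> e = g" using 2 e by (simp add: g_def minus_eq l_distr l_minus)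
    have gf: "g \<otimes> f = \<zero>" using fg gR 2 by (simp add: m_comm)
    have "g \<otimes> (e \<ominus> f) = g \<otimes> e \<ominus> g \<otimes> f"
      using 2 e gR by (simp add: minus_eq r_distr r_minus)
    then have "g \<otimes> g = g \<otimes> e \<ominus> g \<otimes> f" by (simp only: g_def[symmetric])
    then have gg: "g \<otimes> g = g" using ge gf gR by (simp add: minus_eq)
    have sum: "f \<oplus> g = e" using 2 e by (simp add: g_def minus_eq a_lcomm r_neg)
    have "g \<noteq> e"
    proof
      assume "g = e"
      then have "f = \<zero>" using fg 2 by simp
      then show False using 2 by simp
    qed
    then obtain ks v ls u where "staircase_valuation R f ks v" "staircase_valuation R g ls u"
      using smaller[OF 2(1,2,3,5)] smaller[OF gR gg ge] by blast
    then have "staircase_valuation R (f \<oplus> g) (ks @ ls) (\<lambda>x. v x @ u x)"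
      using staircase_valuation_add 2 gR gg fg by blast
    then show ?thesis unfolding sum by blast
  next
    case 3
    then show ?thesis using staircase_valuation_primitive_idempotent[OF fin e] by blast
  qed
qed

section \<open>Valuations as graph isomorphisms\<close>

lemma tensor_product_staircases_verts:
  "pverts (tensor_product_list (map staircase_graph ks)) = {xs. list_all2 (\<le>) xs ks}"
  by (auto simp: pverts_tensor_product_list staircase_graph_def list_all2_conv_all_nth)

lemma tensor_product_staircases_arcs:
  assumes "list_all2 (\<le>) xs ks" "list_all2 (\<le>) ys ks"
  shows "(xs, ys) \<in> parcs (tensor_product_list (map staircase_graph ks)) \<longleftrightarrow>
    (\<forall>i<length ks. ks ! i \<le> xs ! i + ys ! i)"
  using assms
  by (auto simp: parcs_tensor_product_list staircase_graph_def list_all2_conv_all_nth)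

lemma pair_wf_digraph_tensor_product_staircases:
  "pair_wf_digraph (tensor_product_list (map staircase_graph ks))"
  by unfold_locales
    (auto simp: tensor_product_staircases_verts parcs_tensor_product_list staircase_graph_def
      list_all2_conv_all_nth)

lemma (in cring) pair_wf_digraph_Theta: "pair_wf_digraph (Theta R)"
  by unfold_locales (auto simp: Theta_def intro: quotientI)

text \<open>An isomorphism composed with the class map is a valuation: adjacency is
  \<open>v_zero_iff\<close>, and injectivity on classes is \<open>v_eq_imp\<close>. Conversely, a
  valuation is constant on classes and separates them, so it descends to a bijection.\<close>

lemma (in cring) Theta_iso_tensor_product_staircases_iff:
  "digraph_iso (with_proj (Theta R)) (with_proj (tensor_product_list (map staircase_graph ks)))
    \<longleftrightarrow> (\<exists>v. staircase_valuation R \<one> ks v)" (is "?iso \<longleftrightarrow> ?val")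
proof -
  let ?T = "tensor_product_list (map staircase_graph ks)"
  let ?c = "\<lambda>x. unit_assoc R `` {x}"
  have class_eq: "?c x = ?c y \<longleftrightarrow> (x, y) \<in> unit_assoc R"
    if "x \<in> carrier R" "y \<in> carrier R" for x y
    by (rule eq_equiv_class_iff[OF unit_assoc_equiv that])
  have class_verts: "pverts (Theta R) = ?c ` carrier R"
    by (auto simp: Theta_def quotient_def)
  have iso_iff: "?iso \<longleftrightarrow> (\<exists>f. bij_betw f (?c ` carrier R) {xs. list_all2 (\<le>) xs ks} \<and>
      (\<forall>x\<in>carrier R. \<forall>y\<in>carrier R. x \<otimes> y = \<zero> \<longleftrightarrow> (f (?c x), f (?c y)) \<in> parcs ?T))"
    unfolding digraph_iso_with_proj_iff[OF pair_wf_digraph_Theta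
        pair_wf_digraph_tensor_product_staircases]
    by (simp add: class_verts tensor_product_staircases_verts Theta_adjacent_iff)
  show ?thesis
  proof
    assume ?iso
    then obtain f where bij: "bij_betw f (?c ` carrier R) {xs. list_all2 (\<le>) xs ks}"
      and adj: "\<And>x y. x \<in> carrier R \<Longrightarrow> y \<in> carrier R \<Longrightarrow>
        x \<otimes> y = \<zero> \<longleftrightarrow> (f (?c x), f (?c y)) \<in> parcs ?T"
      unfolding iso_iff by blast
    have bounded: "list_all2 (\<le>) (f (?c x)) ks" if "x \<in> carrier R" for x
      using bij_betwE[OF bij] that by simp
    have "staircase_valuation R \<one> ks (\<lambda>x. f (?c x))"
    proof unfold_locales
      show "\<exists>x\<in>carrier R. f (?c x) = xs" if "list_all2 (\<le>) xs ks" for xs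
      proof -
        have "xs \<in> f ` ?c ` carrier R" using bij_betw_imp_surj_on[OF bij] that by simp
        then show ?thesis by blast
      qed
      show "\<exists>w\<in>carrier R. \<exists>w'\<in>carrier R. x \<otimes> \<one> = y \<otimes> w \<otimes> \<one> \<and> w \<otimes> w' \<otimes> \<one> = \<one>"
        if x: "x \<in> carrier R" and y: "y \<in> carrier R" and eq: "f (?c x) = f (?c y)" for x y
      proof -
        have "?c x = ?c y" using bij_betw_imp_inj_on[OF bij] eq x y by (auto dest: inj_onD)
        then obtain u where u: "u \<in> Units R" "x = y \<otimes> u"
          using class_eq[OF x y] by (auto simp: unit_assoc_def)
        then show ?thesis
          using y by (intro bexI[of _ u] bexI[of _ "inv u"]) (auto simp: Units_closed)
      qed
    qed (simp_all add: bounded adj tensor_product_staircases_arcs)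
    then show ?val by blast
  next
    assume ?val
    then obtain v where v: "staircase_valuation R \<one> ks v" by blast
    interpret V: unital_staircase_valuation R ks v
      using v by (rule unital_staircase_valuation.intro)
    have v_eq_iff: "v x = v y \<longleftrightarrow> ?c x = ?c y" if x: "x \<in> carrier R" and y: "y \<in> carrier R" for x y
    proof
      assume "v x = v y"
      then obtain w w' where w: "w \<in> carrier R" "w' \<in> carrier R" "x = y \<otimes> w" "w \<otimes> w' = \<one>"
        using V.v_eq_imp[OF x y] x y by (metis m_closed r_one)
      then have "w \<in> Units R" unfolding Units_def by (auto simp: m_comm)
      then have "(x, y) \<in> unit_assoc R" using w x y by (auto simp: unit_assoc_def)
      then show "?c x = ?c y" using class_eq x y by simp
    next
      \<comment> \<open>Associated elements are multiples of each other, so \<open>v_le_mult\<close>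
        applies in both directions.\<close>
      have le: "v b ! i \<le> v a ! i" if "(a, b) \<in> unit_assoc R" "i < length ks" for a b i
        using that V.v_le_mult by (auto simp: unit_assoc_def Units_closed)
      assume "?c x = ?c y"
      then have "(x, y) \<in> unit_assoc R" "(y, x) \<in> unit_assoc R" using class_eq x y by metis+
      then show "v x = v y" using x y by (intro V.v_eqI antisym le) auto
    qed
    \<comment> \<open>\<open>v\<close> at a chosen representative; by \<open>v_eq_iff\<close> the
      choice does not matter.\<close>
    define f where "f C = v (SOME x. x \<in> carrier R \<and> C = ?c x)" for C
    have f: "f (?c x) = v x" if x: "x \<in> carrier R" for x
    proof -
      let ?y = "SOME y. y \<in> carrier R \<and> ?c x = ?c y"
      have "\<exists>y. y \<in> carrier R \<and> ?c x = ?c y" using x by blast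
      then have "?y \<in> carrier R \<and> ?c x = ?c ?y" by (rule someI_ex)
      then have "v x = v ?y" using v_eq_iff x by simp
      then show ?thesis by (simp add: f_def)
    qed
    have "bij_betw f (?c ` carrier R) {xs. list_all2 (\<le>) xs ks}"
    proof (rule bij_betw_imageI)
      show "inj_on f (?c ` carrier R)" using v_eq_iff by (auto simp: inj_on_def f)
      have "f ` ?c ` carrier R = v ` carrier R" by (simp add: image_image f)
      also have "\<dots> = {xs. list_all2 (\<le>) xs ks}" using V.v_bounded V.v_surj by blast
      finally show "f ` ?c ` carrier R = {xs. list_all2 (\<le>) xs ks}" .
    qed
    moreover have "x \<otimes> y = \<zero> \<longleftrightarrow> (f (?c x), f (?c y)) \<in> parcs ?T"
      if "x \<in> carrier R" "y \<in> carrier R" for x y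
      using V.v_zero_iff[OF that] that
      by (simp add: f tensor_product_staircases_arcs V.v_bounded)
    ultimately show ?iso unfolding iso_iff by blast
  qed
qed

theorem theorem5p8:
  fixes K :: "('a, 'b) ring_scheme"
  assumes "cring K" and "finite (carrier K)"
  shows "principal_ideal_ring K \<longleftrightarrow>
    (\<exists>ks :: nat list. digraph_iso (with_proj (Theta K))
      (with_proj (tensor_product_list (map staircase_graph ks))))"
proof -
  interpret cring K by (rule assms)
  \<comment> \<open>The forward direction takes the idempotent one in
    \<open>staircase_valuation_idempotent\<close>.\<close>
  have "principal_ideal_ring K \<longleftrightarrow> (\<exists>ks v. staircase_valuation K \<one>\<^bsub>K\<^esub> ks v)"
    using principal_ideal_ring.staircase_valuation_idempotent[OF _ assms(2), of "\<one>\<^bsub>K\<^esub>"]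
      unital_staircase_valuation.principal_ideal_ring unital_staircase_valuation.intro
    by (metis one_closed l_one)
  then show ?thesis by (simp add: Theta_iso_tensor_product_staircases_iff)
qed

end
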